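(* Let $T$ be a tree with root $r$ and edge weights $w:E(T)\to\mathbb{N}$. Let $P_1,\dots,P_t$ be an $r$-maximal (weighted) path partition of $T$, indexed so that $w(P_1)\ge w(P_2)\ge\cdots\ge w(P_t)$, and set $f_k^w(T,r)=k\,w(P_1)+\sum_{i=2}^t w(P_i)-t+1$. Then for every positive integer $k$, $\pi_k^w(T,r)\le f_k^w(T,r)$.
   Context: A configuration on $T$ assigns a nonnegative integer number of pebbles to each vertex; its size is the total number of pebbles. A $w$-weighted pebbling move along an edge $e=uv$ removes $w_e=w(e)$ pebbles from one endpoint and places one pebble on the other endpoint. $\pi_k^w(T,r)$ is the minimum $m$ such that from every configuration of size $m$ one can, using $w$-weighted pebbling moves, obtain at least $k$ pebbles on $r$. The weight $w(P)$ of a path $P$ is the product of the weights of its edges. An $r$-path partition of $T$ is a partition of $E(T)$ into paths $P_1,\dots,P_t$ obtained from a sequence of pairs $(T_i,F_i)$, $i=0,\dots,t$ (each $T_i$ a tree, each $F_i$ a forest, $E(T_i)\cup E(F_i)=E(T)$, $E(T_i)\cap E(F_i)=\emptyset$), with $T_0$ the single vertex $r$, $F_0=T$, $T_t=T$, $F_t$ edgeless, such that $T_i=T_{i-1}\cup P_i$, $F_i$ is $F_{i-1}$ minus the edges of $P_i$, and $V(P_i)\cap V(T_{i-1})$ is a single vertex which is an endpoint of $P_i$. The partition is $r$-maximal (weighted version) if at each step $P_i$ is a path of greatest weight among all paths in $F_{i-1}$ meeting $T_{i-1}$ in exactly one vertex which is an endpoint of the path. *)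

theory Defs
  imports Main "HOL-Library.Multiset" "HOL-Library.Disjoint_Sets"
begin

datatype 'a ugraph = UGraph (verts: "'a set") (edges: "'a set set")

definition simple_graph :: "'a ugraph \<Rightarrow> bool" where
  "simple_graph G \<longleftrightarrow> finite (verts G) \<and> (\<forall>e\<in>edges G. e \<subseteq> verts G \<and> card e = 2)"

text \<open>A path is given by its vertex sequence; a list and its reversal describe the same path, and
  a singleton list is the edgeless path.\<close>

definition is_path :: "'a ugraph \<Rightarrow> 'a list \<Rightarrow> bool" where
  "is_path G xs \<longleftrightarrow> xs \<noteq> [] \<and> distinct xs \<and> set xs \<subseteq> verts G \<and>
     (\<forall>i. Suc i < length xs \<longrightarrow> {xs ! i, xs ! Suc i} \<in> edges G)"

definition path_edges :: "'a list \<Rightarrow> 'a set set" where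
  "path_edges xs = {{xs ! i, xs ! Suc i} | i. Suc i < length xs}"

definition is_cycle :: "'a ugraph \<Rightarrow> 'a list \<Rightarrow> bool" where
  "is_cycle G xs \<longleftrightarrow> is_path G xs \<and> length xs \<ge> 3 \<and> {last xs, hd xs} \<in> edges G"

definition connected_graph :: "'a ugraph \<Rightarrow> bool" where
  "connected_graph G \<longleftrightarrow>
     (\<forall>u\<in>verts G. \<forall>v\<in>verts G. \<exists>xs. is_path G xs \<and> hd xs = u \<and> last xs = v)"

definition forest :: "'a ugraph \<Rightarrow> bool" where
  "forest G \<longleftrightarrow> simple_graph G \<and> (\<nexists>xs. is_cycle G xs)"

definition tree :: "'a ugraph \<Rightarrow> bool" where
  "tree G \<longleftrightarrow> forest G \<and> verts G \<noteq> {} \<and> connected_graph G"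

definition path_weight :: "('a set \<Rightarrow> nat) \<Rightarrow> 'a list \<Rightarrow> nat" where
  "path_weight w P = (\<Prod>e\<in>path_edges P. w e)"

definition config_size :: "'a ugraph \<Rightarrow> ('a \<Rightarrow> nat) \<Rightarrow> nat" where
  "config_size G c = (\<Sum>v\<in>verts G. c v)"

definition pebbling_move :: "'a ugraph \<Rightarrow> ('a set \<Rightarrow> nat) \<Rightarrow> ('a \<Rightarrow> nat) \<Rightarrow> ('a \<Rightarrow> nat) \<Rightarrow> bool" where
  "pebbling_move G w c c' \<longleftrightarrow>
     (\<exists>u v. u \<noteq> v \<and> {u, v} \<in> edges G \<and> w {u, v} \<le> c u \<and>
        c' = c(u := c u - w {u, v}, v := c v + 1))"

definition solvable :: "'a ugraph \<Rightarrow> ('a set \<Rightarrow> nat) \<Rightarrow> 'a \<Rightarrow> nat \<Rightarrow> ('a \<Rightarrow> nat) \<Rightarrow> bool" where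
  "solvable G w r k c \<longleftrightarrow> (\<exists>d. (pebbling_move G w)\<^sup>*\<^sup>* c d \<and> d r \<ge> k)"

definition pebbling_number :: "'a ugraph \<Rightarrow> ('a set \<Rightarrow> nat) \<Rightarrow> 'a \<Rightarrow> nat \<Rightarrow> nat" where
  "pebbling_number G w r k = (LEAST m. \<forall>c. config_size G c = m \<longrightarrow> solvable G w r k c)"

definition meets_at_endpoint :: "'a ugraph \<Rightarrow> 'a list \<Rightarrow> bool" where
  "meets_at_endpoint H P \<longleftrightarrow> (\<exists>v. set P \<inter> verts H = {v} \<and> (v = hd P \<or> v = last P))"

text \<open>Lists are indexed from 0, so \<open>Ps ! i\<close> is the path leading from \<open>(Ts i, Fs i)\<close> to
  \<open>(Ts (Suc i), Fs (Suc i))\<close>.\<close>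

definition path_sequence ::
    "'a ugraph \<Rightarrow> 'a \<Rightarrow> 'a list list \<Rightarrow> (nat \<Rightarrow> 'a ugraph) \<Rightarrow> (nat \<Rightarrow> 'a ugraph) \<Rightarrow> bool" where
  "path_sequence G r Ps Ts Fs \<longleftrightarrow>
     partition_on (edges G) (path_edges ` set Ps) \<and>
     (\<forall>i\<le>length Ps. tree (Ts i) \<and> forest (Fs i) \<and>
        edges (Ts i) \<union> edges (Fs i) = edges G \<and> edges (Ts i) \<inter> edges (Fs i) = {}) \<and>
     Ts 0 = UGraph {r} {} \<and> Fs 0 = G \<and>
     Ts (length Ps) = G \<and> edges (Fs (length Ps)) = {} \<and>
     (\<forall>i<length Ps.
        is_path (Fs i) (Ps ! i) \<and> meets_at_endpoint (Ts i) (Ps ! i) \<and>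
        Ts (Suc i) = UGraph (verts (Ts i) \<union> set (Ps ! i)) (edges (Ts i) \<union> path_edges (Ps ! i)) \<and>
        Fs (Suc i) = UGraph (verts (Fs i)) (edges (Fs i) - path_edges (Ps ! i)))"

definition r_maximal_path_sequence ::
    "'a ugraph \<Rightarrow> 'a \<Rightarrow> ('a set \<Rightarrow> nat) \<Rightarrow> 'a list list \<Rightarrow> bool" where
  "r_maximal_path_sequence G r w Ps \<longleftrightarrow>
     (\<exists>Ts Fs. path_sequence G r Ps Ts Fs \<and>
        (\<forall>i<length Ps. \<forall>Q. is_path (Fs i) Q \<and> meets_at_endpoint (Ts i) Q \<longrightarrow>
           path_weight w Q \<le> path_weight w (Ps ! i)))"

text \<open>A partition carries no order, so \<open>Ps\<close> may list its paths in an order different from the one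
  in which they were chosen.\<close>

definition r_maximal_path_partition ::
    "'a ugraph \<Rightarrow> 'a \<Rightarrow> ('a set \<Rightarrow> nat) \<Rightarrow> 'a list list \<Rightarrow> bool" where
  "r_maximal_path_partition G r w Ps \<longleftrightarrow>
     (\<exists>Qs. mset Qs = mset Ps \<and> r_maximal_path_sequence G r w Qs)"

text \<open>Integer-valued, to avoid truncated subtraction; meaningful for nonempty \<open>Ps\<close> only.\<close>

definition f_bound :: "('a set \<Rightarrow> nat) \<Rightarrow> nat \<Rightarrow> 'a list list \<Rightarrow> int" where
  "f_bound w k Ps =
     int k * int (path_weight w (Ps ! 0)) + (\<Sum>i=1..<length Ps. int (path_weight w (Ps ! i)))
       - int (length Ps) + 1"

end

theory Submission
  imports Defs
begin

text \<open>
  Orient \<open>T\<close> towards \<open>r\<close>. Let \<open>H v\<close> be the weight of the part below \<open>v\<close> of the path of the partition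
  that enters \<open>v\<close> from above, and let \<open>H r\<close> be the weight of the first chosen path. Maximality gives
  \<open>w(uv) * H u \<le> H v\<close> for every child \<open>u\<close> of \<open>v\<close>, so the potential \<open>\<Sum>v. c v * H v\<close>, which is at
  least the size of \<open>c\<close>, never decreases under moves towards the root. When no such move is possible,
  every \<open>u \<noteq> r\<close> carries at most \<open>w(uv) - 1\<close> pebbles; hence the size of the initial configuration is at
  most \<open>d r * H r + \<Sum>u. (w(uv) - 1) * H u\<close> for the final configuration \<open>d\<close>. Along each path of the
  partition the last sum telescopes to \<open>w(P) - 1\<close>.
\<close>

section \<open>Edge sets and weights of vertex lists\<close>

lemma path_edges_simps [simp]:
  "path_edges [] = {}"
  "path_edges [x] = {}"
  "path_edges (x # y # zs) = insert {x, y} (path_edges (y # zs))"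
proof -
  show "path_edges (x # y # zs) = insert {x, y} (path_edges (y # zs))"
  proof (intro equalityI subsetI)
    fix e assume "e \<in> path_edges (x # y # zs)"
    then obtain i where "Suc i < length (x # y # zs)" "e = {(x # y # zs) ! i, (x # y # zs) ! Suc i}"
      by (auto simp: path_edges_def)
    then show "e \<in> insert {x, y} (path_edges (y # zs))"
      by (cases i) (auto simp: path_edges_def)
  next
    fix e assume "e \<in> insert {x, y} (path_edges (y # zs))"
    then consider "e = {x, y}"
      | i where "Suc i < length (y # zs)" "e = {(y # zs) ! i, (y # zs) ! Suc i}"
      by (auto simp: path_edges_def)
    then show "e \<in> path_edges (x # y # zs)"
    proof cases
      case 1
      then show ?thesis unfolding path_edges_def by (intro CollectI exI[of _ 0]) simp
    next
      case 2
      then show ?thesis unfolding path_edges_def by (intro CollectI exI[of _ "Suc i"]) simp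
    qed
  qed
qed (simp_all add: path_edges_def)

text \<open>Index-free form, in which reversing, gluing and changing the graph reduce to set
  inclusions.\<close>

lemma is_path_iff:
  "is_path G xs \<longleftrightarrow> xs \<noteq> [] \<and> distinct xs \<and> set xs \<subseteq> verts G \<and> path_edges xs \<subseteq> edges G"
  by (auto simp: is_path_def path_edges_def)

lemma path_edges_append:
  "path_edges (xs @ v # ys) = path_edges (xs @ [v]) \<union> path_edges (v # ys)"
proof (induction xs)
  case (Cons x xs)
  then show ?case by (cases xs) auto
qed simp

lemma path_edges_rev [simp]: "path_edges (rev xs) = path_edges xs"
proof (induction xs rule: induct_list012)
  case (3 x y zs)
  have "path_edges (rev (x # y # zs)) = path_edges (rev (y # zs)) \<union> path_edges [y, x]"
    using path_edges_append[of "rev zs" y "[x]"] by simp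
  then show ?case using 3 by (auto simp: insert_commute)
qed simp_all

lemma is_path_rev [simp]: "is_path G (rev xs) \<longleftrightarrow> is_path G xs"
  by (simp add: is_path_iff)

lemma path_weight_rev [simp]: "path_weight w (rev xs) = path_weight w xs"
  by (simp add: path_weight_def)

lemma finite_path_edges [simp]: "finite (path_edges xs)"
  by (induction xs rule: induct_list012) auto

lemma path_edges_subset: "e \<in> path_edges xs \<Longrightarrow> e \<subseteq> set xs"
  by (induction xs rule: induct_list012) auto

lemma path_weight_single [simp]: "path_weight w [x] = 1"
  by (simp add: path_weight_def)

text \<open>The weight is a product over a set of edges; as \<open>x\<close> is absent from the
  rest, the first edge is a genuinely new factor.\<close>

lemma path_weight_Cons:
  assumes "x \<notin> set (y # zs)"
  shows "path_weight w (x # y # zs) = w {x, y} * path_weight w (y # zs)"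
proof -
  have "{x, y} \<notin> path_edges (y # zs)"
    using assms path_edges_subset[of "{x, y}" "y # zs"] by auto
  then show ?thesis by (simp add: path_weight_def)
qed

lemma path_weight_append:
  assumes "distinct (xs @ v # ys)"
  shows "path_weight w (xs @ v # ys) = path_weight w (xs @ [v]) * path_weight w (v # ys)"
  using assms
proof (induction xs)
  case (Cons x xs)
  show ?case
  proof (cases xs)
    case Nil
    then show ?thesis using Cons.prems by (simp add: path_weight_Cons)
  next
    case (Cons x' xs')
    then show ?thesis using Cons.IH Cons.prems by (simp add: path_weight_Cons)
  qed
qed simp

lemma path_weight_pos:
  assumes "path_edges xs \<subseteq> E" "\<forall>e\<in>E. w e > 0"
  shows "path_weight w xs > 0"
  unfolding path_weight_def using assms by (auto intro!: prod_pos)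

section \<open>Potentials on the rooted tree\<close>

text \<open>\<open>V\<close> is the part labelled so far, while \<open>E\<close> may be the edge set
  of the whole tree. The decrease of \<open>dep\<close> along \<open>par\<close> excludes cycles and
  makes moving pebbles to the parent terminate.\<close>

definition upward_labelling ::
    "('a set \<Rightarrow> nat) \<Rightarrow> 'a set set \<Rightarrow> 'a \<Rightarrow> 'a set \<Rightarrow> ('a \<Rightarrow> 'a) \<Rightarrow> ('a \<Rightarrow> nat) \<Rightarrow> ('a \<Rightarrow> nat) \<Rightarrow> bool"
  where
  "upward_labelling w E r V par dep H \<longleftrightarrow> finite V \<and> r \<in> V \<and> (\<forall>u\<in>V. 1 \<le> H u) \<and>
     (\<forall>u\<in>V - {r}. par u \<in> V \<and> {u, par u} \<in> E \<and> dep (par u) < dep u \<and>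
        w {u, par u} * H u \<le> H (par u))"

text \<open>The largest potential that can be left outside the root when no move to a parent is
  possible.\<close>

definition label_sum :: "('a set \<Rightarrow> nat) \<Rightarrow> 'a \<Rightarrow> 'a set \<Rightarrow> ('a \<Rightarrow> 'a) \<Rightarrow> ('a \<Rightarrow> nat) \<Rightarrow> nat" where
  "label_sum w r V par H = (\<Sum>u\<in>V - {r}. (w {u, par u} - 1) * H u)"

text \<open>The old contributions are added on the left, which avoids truncated subtraction.\<close>

lemma sum_fun_upd_two:
  fixes c :: "'a \<Rightarrow> nat"
  assumes "finite V" "u \<in> V" "v \<in> V" "u \<noteq> v"
  shows "(\<Sum>x\<in>V. (c(u := a, v := b)) x * g x) + c u * g u + c v * g v
    = (\<Sum>x\<in>V. c x * g x) + a * g u + b * g v"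
proof -
  have "V = insert u (insert v (V - {u, v}))" using assms by auto
  then obtain V' where V': "V = insert u (insert v V')" "u \<notin> V'" "v \<notin> V'" by blast
  have "finite V'" using V' assms(1) by simp
  moreover have "(\<Sum>x\<in>V'. (c(u := a, v := b)) x * g x) = (\<Sum>x\<in>V'. c x * g x)"
    using V' by (intro sum.cong) auto
  ultimately show ?thesis using V' assms(4) by simp
qed

lemma push_pebbles_to_root:
  assumes lab: "upward_labelling w (edges G) r V par dep H"
    and wpos: "\<forall>e\<in>edges G. w e > 0"
  shows "\<exists>d. (pebbling_move G w)\<^sup>*\<^sup>* c d \<and>
    (\<Sum>v\<in>V. c v * H v) \<le> d r * H r + label_sum w r V par H"
proof (induction "\<Sum>v\<in>V. c v * dep v" arbitrary: c rule: less_induct)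
  case less
  have fin: "finite V" and rV: "r \<in> V"
    using lab by (auto simp: upward_labelling_def)
  show ?case
  proof (cases "\<exists>u\<in>V - {r}. w {u, par u} \<le> c u")
    case True
    then obtain u where u: "u \<in> V" "u \<noteq> r" and le: "w {u, par u} \<le> c u" by blast
    let ?v = "par u" and ?a = "w {u, par u}"
    have v: "?v \<in> V" "{u, ?v} \<in> edges G" "dep ?v < dep u" "?a * H u \<le> H ?v"
      using lab u by (auto simp: upward_labelling_def)
    have uv: "u \<noteq> ?v" using v(3) by auto
    have a: "?a > 0" using v(2) wpos by blast
    let ?c = "c(u := c u - ?a, ?v := c ?v + 1)"
    have move: "pebbling_move G w c ?c"
      unfolding pebbling_move_def using uv v(2) le by blast
    obtain b where b: "c u = ?a + b" using le le_Suc_ex by blast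
    \<comment> \<open>Used twice: with \<open>dep\<close> for termination, where at least one pebble
      leaves \<open>u\<close> and only one arrives at its parent, and with \<open>H\<close> for the
      potential.\<close>
    have eq: "(\<Sum>x\<in>V. ?c x * g x) + ?a * g u = (\<Sum>x\<in>V. c x * g x) + g ?v" for g :: "'a \<Rightarrow> nat"
      using sum_fun_upd_two[OF fin u(1) v(1) uv, of c "c u - ?a" "c ?v + 1" g] b
      by (simp add: algebra_simps)
    have "dep u \<le> ?a * dep u" using a by simp
    then have "(\<Sum>x\<in>V. ?c x * dep x) < (\<Sum>x\<in>V. c x * dep x)"
      using eq[of dep] v(3) by linarith
    from less[OF this] obtain d where d: "(pebbling_move G w)\<^sup>*\<^sup>* ?c d"
      "(\<Sum>v\<in>V. ?c v * H v) \<le> d r * H r + label_sum w r V par H" by blast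
    have "(\<Sum>v\<in>V. c v * H v) \<le> (\<Sum>v\<in>V. ?c v * H v)"
      using eq[of H] v(4) by linarith
    then show ?thesis
      using d move by (meson converse_rtranclp_into_rtranclp order_trans)
  next
    case False
    have "(\<Sum>v\<in>V - {r}. c v * H v) \<le> label_sum w r V par H"
      unfolding label_sum_def
    proof (intro sum_mono mult_right_mono)
      fix u assume "u \<in> V - {r}"
      then show "c u \<le> w {u, par u} - 1" using False by force
    qed simp
    then have "(\<Sum>v\<in>V. c v * H v) \<le> c r * H r + label_sum w r V par H"
      by (simp add: sum.remove[OF fin rV])
    then show ?thesis by blast
  qed
qed

lemma solvable_if_labelled:
  assumes lab: "upward_labelling w (edges G) r (verts G) par dep H"
    and wpos: "\<forall>e\<in>edges G. w e > 0"
    and size: "config_size G c > k * H r + label_sum w r (verts G) par H"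
  shows "solvable G w r (Suc k) c"
proof -
  obtain d where d: "(pebbling_move G w)\<^sup>*\<^sup>* c d"
    "(\<Sum>v\<in>verts G. c v * H v) \<le> d r * H r + label_sum w r (verts G) par H"
    using push_pebbles_to_root[OF lab wpos] by blast
  have "config_size G c \<le> (\<Sum>v\<in>verts G. c v * H v)"
    unfolding config_size_def using lab by (intro sum_mono) (auto simp: upward_labelling_def)
  then have "k * H r < d r * H r" using d(2) size by linarith
  then have "Suc k \<le> d r" by simp
  then show ?thesis using d(1) by (auto simp: solvable_def)
qed

section \<open>Attaching one path to a labelled tree\<close>

text \<open>Each new vertex is labelled by the weight of the rest of the path. Its summand is then
  the difference of two consecutive tail weights, so the sum telescopes down to the weight 1 of the
  last vertex; this is the \<open>+ 1\<close> on the left.\<close>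

lemma upward_labelling_extend_path:
  assumes "upward_labelling w E r V par dep H" "x \<in> V" "distinct (x # xs)" "set xs \<inter> V = {}"
    "path_edges (x # xs) \<subseteq> E" "path_weight w (x # xs) \<le> H x" "\<forall>e\<in>E. w e > 0"
  shows "\<exists>par' dep' H'. upward_labelling w E r (V \<union> set xs) par' dep' H' \<and>
    (\<forall>v\<in>V. H' v = H v) \<and>
    label_sum w r (V \<union> set xs) par' H' + 1 = label_sum w r V par H + path_weight w (x # xs) \<and>
    (\<forall>ps v qs. xs = ps @ v # qs \<longrightarrow> H' v = path_weight w (v # qs))"
  using assms
proof (induction xs arbitrary: x V par dep H)
  case Nil
  then show ?case by (intro exI[of _ par] exI[of _ dep] exI[of _ H]) simp
next
  case (Cons y ys)
  note lab = Cons.prems(1) and wpos = Cons.prems(7)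
  let ?W = "path_weight w (y # ys)" and ?a = "w {y, x}"
  let ?par = "par(y := x)" and ?dep = "dep(y := Suc (dep x))" and ?H = "H(y := ?W)"
  have yV: "y \<notin> V" and xy: "x \<noteq> y" using Cons.prems by auto
  have rV: "r \<in> V" and fin: "finite V" using lab by (auto simp: upward_labelling_def)
  have W: "?W \<ge> 1" using path_weight_pos[of "y # ys" E w] Cons.prems by auto
  have a: "?a \<ge> 1" using Cons.prems(5) wpos by (force simp: insert_commute)
  have pw: "path_weight w (x # y # ys) = ?a * ?W"
    using Cons.prems(3) by (simp add: path_weight_Cons insert_commute)
  \<comment> \<open>The inequality at the edge from \<open>y\<close> to \<open>x\<close> is the
    bound on the whole path by \<open>H x\<close>. The same bound for the remaining path at
    \<open>y\<close> holds with equality.\<close>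
  have lab': "upward_labelling w E r (insert y V) ?par ?dep ?H"
    using lab yV W pw Cons.prems(2,5,6) xy
    by (auto simp: upward_labelling_def insert_commute)
  obtain par' dep' H' where IH:
    "upward_labelling w E r (insert y V \<union> set ys) par' dep' H'"
    "\<forall>v\<in>insert y V. H' v = ?H v"
    "label_sum w r (insert y V \<union> set ys) par' H' + 1 = label_sum w r (insert y V) ?par ?H + ?W"
    "\<forall>ps v qs. ys = ps @ v # qs \<longrightarrow> H' v = path_weight w (v # qs)"
  proof -
    have "y \<in> insert y V" "distinct (y # ys)" "set ys \<inter> insert y V = {}"
      "path_edges (y # ys) \<subseteq> E" "?W \<le> ?H y"
      using Cons.prems by auto
    from Cons.IH[OF lab' this wpos] show ?thesis using that by blast
  qed
  have "label_sum w r (insert y V) ?par ?H = (?a - 1) * ?W + label_sum w r V ?par ?H"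
  proof -
    have "insert y V - {r} = insert y (V - {r})" using rV yV by auto
    then show ?thesis using yV fin by (simp add: label_sum_def)
  qed
  also have "label_sum w r V ?par ?H = label_sum w r V par H"
    unfolding label_sum_def using yV by (intro sum.cong) auto
  finally have "label_sum w r (insert y V \<union> set ys) par' H' + 1
      = label_sum w r V par H + path_weight w (x # y # ys)"
    using IH(3) a pw by (cases ?a) (simp_all del: fun_upd_apply)
  moreover have "\<forall>ps v qs. y # ys = ps @ v # qs \<longrightarrow> H' v = path_weight w (v # qs)"
  proof (intro allI impI)
    fix ps v qs assume "y # ys = ps @ v # qs"
    then show "H' v = path_weight w (v # qs)"
      using IH(2,4) by (cases ps) auto
  qed
  moreover have "\<forall>v\<in>V. H' v = H v" using IH(2) yV by auto
  ultimately show ?case using IH(1)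
    by (intro exI[of _ par'] exI[of _ dep'] exI[of _ H']) simp
qed

text \<open>The attaching vertex may be the last entry of the list; reversing then puts it first and
  changes neither edges nor weight.\<close>

lemma oriented_path:
  assumes "is_path F P" "meets_at_endpoint S P"
  obtains x xs where "is_path F (x # xs)" "set (x # xs) = set P" "path_edges (x # xs) = path_edges P"
    "path_weight w (x # xs) = path_weight w P" "x \<in> verts S" "set xs \<inter> verts S = {}"
proof -
  obtain v where v: "set P \<inter> verts S = {v}" "v = hd P \<or> v = last P"
    using assms(2) by (auto simp: meets_at_endpoint_def)
  define R where "R = (if v = hd P then P else rev P)"
  have R: "is_path F R" "set R = set P" "path_edges R = path_edges P"
    "path_weight w R = path_weight w P"
    using assms(1) by (simp_all add: R_def)
  have "P \<noteq> []" using assms(1) by (simp add: is_path_def)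
  then have "R \<noteq> []" "hd R = v" using v(2) by (auto simp: R_def hd_rev)
  then obtain xs where xs: "R = v # xs" by (cases R) auto
  have "v \<notin> set xs" using R(1) xs by (simp add: is_path_def)
  then have "set xs \<inter> verts S = {}" "v \<in> verts S" using v(1) R(2) xs by auto
  then show ?thesis using that R xs by blast
qed

section \<open>Labelling along the maximal path sequence\<close>

text \<open>The last conjunct is the invariant that makes the next extension possible: a path still
  hanging off the current tree at \<open>v\<close> weighs at most \<open>H v\<close>. The summand
  \<open>i\<close> collects the 1 lost to telescoping on each path.\<close>

lemma path_sequence_labelling:
  assumes seq: "path_sequence G r Qs Ts Fs"
    and maxi: "\<forall>i<length Qs. \<forall>Q. is_path (Fs i) Q \<and> meets_at_endpoint (Ts i) Q \<longrightarrow>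
           path_weight w Q \<le> path_weight w (Qs ! i)"
    and ne: "Qs \<noteq> []"
    and wpos: "\<forall>e\<in>edges G. w e > 0"
    and i: "i \<le> length Qs"
  shows "\<exists>par dep H. upward_labelling w (edges G) r (verts (Ts i)) par dep H \<and>
    H r = path_weight w (Qs ! 0) \<and>
    label_sum w r (verts (Ts i)) par H + i = (\<Sum>j<i. path_weight w (Qs ! j)) \<and>
    (\<forall>v R. v \<in> verts (Ts i) \<longrightarrow> is_path (Fs i) (v # R) \<longrightarrow> set R \<inter> verts (Ts i) = {} \<longrightarrow>
      path_weight w (v # R) \<le> H v)"
  using i
proof (induction i)
  case 0
  have T0: "Ts 0 = UGraph {r} {}" and F0: "Fs 0 = G"
    using seq by (auto simp: path_sequence_def)
  have "is_path (Fs 0) (Qs ! 0)" using seq ne by (auto simp: path_sequence_def)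
  then have pos: "path_weight w (Qs ! 0) > 0"
    using path_weight_pos wpos F0 by (metis is_path_iff)
  have "path_weight w (r # R) \<le> path_weight w (Qs ! 0)"
    if "is_path (Fs 0) (r # R)" "set R \<inter> verts (Ts 0) = {}" for R
  proof -
    have "meets_at_endpoint (Ts 0) (r # R)"
      using that T0 by (auto simp: meets_at_endpoint_def)
    then show ?thesis using maxi ne that(1) by blast
  qed
  then show ?case using pos T0
    by (intro exI[of _ "\<lambda>x. x"] exI[of _ "\<lambda>_. 0"] exI[of _ "\<lambda>_. path_weight w (Qs ! 0)"])
       (auto simp: upward_labelling_def label_sum_def)
next
  case (Suc i)
  then have i: "i < length Qs" by simp
  obtain par dep H where lab: "upward_labelling w (edges G) r (verts (Ts i)) par dep H"
    and Hr: "H r = path_weight w (Qs ! 0)"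
    and ls: "label_sum w r (verts (Ts i)) par H + i = (\<Sum>j<i. path_weight w (Qs ! j))"
    and inv: "\<And>v R. v \<in> verts (Ts i) \<Longrightarrow> is_path (Fs i) (v # R) \<Longrightarrow>
        set R \<inter> verts (Ts i) = {} \<Longrightarrow> path_weight w (v # R) \<le> H v"
    using Suc by fastforce
  have step: "is_path (Fs i) (Qs ! i)" "meets_at_endpoint (Ts i) (Qs ! i)"
    "Ts (Suc i) = UGraph (verts (Ts i) \<union> set (Qs ! i)) (edges (Ts i) \<union> path_edges (Qs ! i))"
    "Fs (Suc i) = UGraph (verts (Fs i)) (edges (Fs i) - path_edges (Qs ! i))"
    using seq i by (auto simp: path_sequence_def)
  have "edges (Ts i) \<union> edges (Fs i) = edges G"
    using seq i unfolding path_sequence_def by (meson less_imp_le)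
  then have FG: "edges (Fs i) \<subseteq> edges G" by blast
  obtain x xs where X: "is_path (Fs i) (x # xs)" "set (x # xs) = set (Qs ! i)"
    "path_edges (x # xs) = path_edges (Qs ! i)"
    "path_weight w (x # xs) = path_weight w (Qs ! i)" "x \<in> verts (Ts i)"
    "set xs \<inter> verts (Ts i) = {}"
    using oriented_path[OF step(1,2)] by metis
  have V: "verts (Ts (Suc i)) = verts (Ts i) \<union> set xs"
    using step(3) X(2,5) by auto
  have X': "distinct (x # xs)" "path_edges (x # xs) \<subseteq> edges G"
    using X(1) FG by (auto simp: is_path_iff)
  \<comment> \<open>The invariant, applied to the chosen path itself, gives the bound by
    \<open>H x\<close> required for the extension.\<close>
  obtain par' dep' H' where new:
    "upward_labelling w (edges G) r (verts (Ts (Suc i))) par' dep' H'"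
    "\<And>v. v \<in> verts (Ts i) \<Longrightarrow> H' v = H v"
    "label_sum w r (verts (Ts (Suc i))) par' H' + 1
      = label_sum w r (verts (Ts i)) par H + path_weight w (x # xs)"
    "\<And>ps v qs. xs = ps @ v # qs \<Longrightarrow> H' v = path_weight w (v # qs)"
    using upward_labelling_extend_path[OF lab X(5) X'(1) X(6) X'(2) inv[OF X(5,1,6)] wpos]
    unfolding V by blast
  have sub: "is_path (Fs i) R" if "is_path (Fs (Suc i)) R" for R
    using that step(4) by (auto simp: is_path_iff)
  have inv': "path_weight w (v # R) \<le> H' v"
    if v: "v \<in> verts (Ts (Suc i))" and R: "is_path (Fs (Suc i)) (v # R)"
      and disj: "set R \<inter> verts (Ts (Suc i)) = {}" for v R
  proof (cases "v \<in> verts (Ts i)")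
    case True
    then show ?thesis using inv[OF True sub[OF R]] disj V new(2) by auto
  next
    case False
    then have "v \<in> set xs" using v V by blast
    then obtain ps qs where xs: "xs = ps @ v # qs" by (meson split_list)
    \<comment> \<open>Follow the chosen path down to \<open>v\<close> and then \<open>R\<close>: a competitor of the chosen path.\<close>
    let ?Q = "(x # ps) @ v # R"
    have R': "is_path (Fs i) (v # R)" by (rule sub[OF R])
    have dist: "distinct ?Q"
      using R' X'(1) disj V X(5) xs by (auto simp: is_path_iff)
    have "path_edges ((x # ps) @ [v]) \<subseteq> edges (Fs i)"
      using X(1) path_edges_append[of "x # ps" v qs] xs by (simp add: is_path_iff)
    then have "path_edges ?Q \<subseteq> edges (Fs i)"
      using path_edges_append[of "x # ps" v R] R' by (simp add: is_path_iff)
    moreover have "set ?Q \<subseteq> verts (Fs i)" using R' X(1) xs by (auto simp: is_path_iff)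
    ultimately have "is_path (Fs i) ?Q" using dist unfolding is_path_iff by blast
    moreover have "set ?Q \<inter> verts (Ts i) = {x}"
      using X(5,6) xs disj V by auto
    then have "meets_at_endpoint (Ts i) ?Q" by (simp add: meets_at_endpoint_def)
    ultimately have "path_weight w ?Q \<le> path_weight w (x # xs)" using maxi i X(4) by metis
    moreover have "path_weight w ?Q = path_weight w ((x # ps) @ [v]) * path_weight w (v # R)"
      using path_weight_append[OF dist] .
    \<comment> \<open>The label \<open>H' v\<close> is the weight of \<open>v # qs\<close>, so both
      paths share the factor from \<open>x\<close> to \<open>v\<close>, which is positive and
      cancels.\<close>
    moreover have "path_weight w (x # xs) = path_weight w ((x # ps) @ [v]) * H' v"
      using path_weight_append[of "x # ps" v qs w] X'(1) xs new(4)[OF xs] by simp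
    moreover have "path_weight w ((x # ps) @ [v]) > 0"
      using path_weight_pos[OF _ wpos] \<open>path_edges ((x # ps) @ [v]) \<subseteq> edges (Fs i)\<close> FG by blast
    ultimately show ?thesis by simp
  qed
  have "r \<in> verts (Ts i)" using lab by (simp add: upward_labelling_def)
  then have "H' r = path_weight w (Qs ! 0)" using new(2) Hr by simp
  moreover have "label_sum w r (verts (Ts (Suc i))) par' H' + Suc i
      = (\<Sum>j<Suc i. path_weight w (Qs ! j))"
    using new(3) ls X(4) by simp
  ultimately show ?case using new(1) inv' by blast
qed

section \<open>From the labelling to the bound \<open>f_bound\<close>\<close>

theorem theorem6:
  fixes T :: "'a ugraph" and r :: 'a and w :: "'a set \<Rightarrow> nat"
    and Ps :: "'a list list" and k :: nat
  assumes "tree T" and "r \<in> verts T"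
    and "\<forall>e\<in>edges T. w e > 0"
    and "r_maximal_path_partition T r w Ps"
    and "Ps \<noteq> []"
    and "sorted_wrt (\<ge>) (map (path_weight w) Ps)"
    and "k > 0"
  shows "int (pebbling_number T w r k) \<le> f_bound w k Ps"
proof -
  obtain Qs Ts Fs where mset: "mset Qs = mset Ps" and seq: "path_sequence T r Qs Ts Fs"
    and maxi: "\<forall>i<length Qs. \<forall>Q. is_path (Fs i) Q \<and> meets_at_endpoint (Ts i) Q \<longrightarrow>
           path_weight w Q \<le> path_weight w (Qs ! i)"
    using assms(4) unfolding r_maximal_path_partition_def r_maximal_path_sequence_def by blast
  have ne: "Qs \<noteq> []" using mset assms(5) by auto
  have len: "length Qs = length Ps" using mset by (rule mset_eq_length)
  have end_T: "Ts (length Qs) = T" using seq by (simp add: path_sequence_def)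
  obtain par dep H where lab: "upward_labelling w (edges T) r (verts T) par dep H"
    and Hr: "H r = path_weight w (Qs ! 0)"
    and ls: "label_sum w r (verts T) par H + length Qs = (\<Sum>j<length Qs. path_weight w (Qs ! j))"
    using path_sequence_labelling[OF seq maxi ne assms(3) order_refl] unfolding end_T by blast
  let ?p = "\<lambda>i. path_weight w (Ps ! i)"
  obtain p Ps' where Ps: "Ps = p # Ps'" using assms(5) by (cases Ps) auto
  have "Qs ! 0 \<in> set Ps" using ne mset by (metis length_greater_0_conv nth_mem set_mset_mset)
  \<comment> \<open>\<open>Qs\<close> is in order of choice, \<open>Ps\<close> in order of weight,
    so the head of \<open>Ps\<close> dominates the first chosen path.\<close>
  then have Hr_le: "H r \<le> ?p 0" using Hr assms(6) Ps by auto
  have "(\<Sum>j<length Qs. path_weight w (Qs ! j)) = sum_list (map (path_weight w) Qs)"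
    by (simp add: sum_list_sum_nth atLeast0LessThan)
  also have "\<dots> = sum_list (map (path_weight w) Ps)"
    using mset by (metis mset_map sum_mset_sum_list)
  also have "\<dots> = (\<Sum>j<length Ps. ?p j)"
    by (simp add: sum_list_sum_nth atLeast0LessThan)
  also have "\<dots> = ?p 0 + (\<Sum>j=1..<length Ps. ?p j)"
    using assms(5) by (simp add: sum.atLeast_Suc_lessThan flip: atLeast0LessThan)
  finally have total: "label_sum w r (verts T) par H + length Ps = ?p 0 + (\<Sum>j=1..<length Ps. ?p j)"
    using ls len by simp
  obtain k' where k': "k = Suc k'" using assms(7) gr0_implies_Suc by blast
  \<comment> \<open>One more than the size up to which only \<open>k'\<close> pebbles are
    guaranteed. As \<open>label_sum\<close> is the total path weight minus the number of paths, this
    equals \<open>f_bound\<close>, with one copy of \<open>?p 0\<close> coming from the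
    total.\<close>
  let ?m = "k' * ?p 0 + label_sum w r (verts T) par H + 1"
  have "int (label_sum w r (verts T) par H) + int (length Ps)
      = int (?p 0) + (\<Sum>j=1..<length Ps. int (?p j))"
    using total by (metis of_nat_add of_nat_sum)
  then have f: "f_bound w k Ps = int ?m"
    by (simp add: f_bound_def k' algebra_simps)
  have "solvable T w r k c" if "config_size T c = ?m" for c
    unfolding k'
  proof (rule solvable_if_labelled[OF lab assms(3)])
    have "k' * H r \<le> k' * ?p 0" using Hr_le by simp
    then show "config_size T c > k' * H r + label_sum w r (verts T) par H"
      using that by linarith
  qed
  then have "pebbling_number T w r k \<le> ?m"
    unfolding pebbling_number_def by (intro Least_le) blast
  then show ?thesis unfolding f by (rule of_nat_mono)
qed

end
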